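(* Let $g\ge 2$ be an integer and let $G$ be an extra-special group of order $2^{2g+1}$, with center $Z(G)=\langle z\rangle$ of order $2$. Then $G$ is an admissible quotient of $\mathsf{B}_2(\Sigma_g)$ if and only if $g$ is odd. In this case, for every generating vector $(\mathsf{a}_1,\mathsf{b}_1,\dots,\mathsf{a}_g,\mathsf{b}_g,\mathsf{s})$ of $G$ we have $\mathsf{s}^2=z$.
   Context: Commutators are $[x,y]=xyx^{-1}y^{-1}$. Let $\Sigma_g$ be a compact Riemann surface of genus $g$. The full braid group on two strings $\mathsf{B}_2(\Sigma_g)\simeq\pi_1(\operatorname{Sym}^2\Sigma_g-\delta)$ (with $\delta$ the diagonal) is the group generated by $a_1,b_1,\dots,a_g,b_g,\sigma$ subject to the relations: $[a_i,\sigma^{-1}a_i\sigma^{-1}]=1$ and $[b_i,\sigma^{-1}b_i\sigma^{-1}]=1$ for $1\le i\le g$; $[a_i,\sigma^{-1}a_j\sigma]=[a_i,\sigma^{-1}b_j\sigma]=[b_i,\sigma^{-1}a_j\sigma]=[b_i,\sigma^{-1}b_j\sigma]=1$ for $j<i$; $[a_i,\sigma^{-1}b_i\sigma^{-1}]=\sigma^2$ for $1\le i\le g$; and $[a_1,b_1^{-1}]\cdots[a_g,b_g^{-1}]=\sigma^2$. For a finite group $G$, a group epimorphism $\varphi\colon\mathsf{B}_2(\Sigma_g)\to G$ is called admissible if $\varphi(\sigma)$ has order $n\ge 2$ (i.e. $\varphi(\sigma)\neq 1$); $G$ is called an admissible quotient of $\mathsf{B}_2(\Sigma_g)$ if such a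 $\varphi$ exists. The generating vector of an admissible epimorphism $\varphi$ is the ordered tuple $(\mathsf{a}_1,\mathsf{b}_1,\dots,\mathsf{a}_g,\mathsf{b}_g,\mathsf{s})=(\varphi(a_1),\varphi(b_1),\dots,\varphi(a_g),\varphi(b_g),\varphi(\sigma))$; the generating vectors of $G$ are the tuples arising in this way. A finite $p$-group $G$ is extra-special if its center $Z(G)$ is cyclic of order $p$ and $G/Z(G)$ is a nontrivial elementary abelian $p$-group. *)

theory Defs
  imports "HOL-Algebra.Elementary_Groups" "HOL-Algebra.Multiplicative_Group"
    "HOL-Computational_Algebra.Primes"
begin

section \<open>Groups given by generators and relations\<close>

text \<open>A letter \<open>(x, True)\<close> stands for the generator \<open>x\<close>, and \<open>(x, False)\<close> for its formal inverse.
  Relations are pairs of words: \<open>(l, r)\<close> stands for \<open>l = r\<close>.\<close>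

type_synonym 'x word = "('x \<times> bool) list"

definition words :: "'x set \<Rightarrow> 'x word set" where
  "words X = lists (X \<times> UNIV)"

definition gen :: "'x \<Rightarrow> 'x word" where
  "gen x = [(x, True)]"

definition inv_word :: "'x word \<Rightarrow> 'x word" where
  "inv_word w = map (\<lambda>(x, e). (x, \<not> e)) (rev w)"

definition comm_word :: "'x word \<Rightarrow> 'x word \<Rightarrow> 'x word" where
  "comm_word u v = u @ v @ inv_word u @ inv_word v"

inductive word_cong :: "'x set \<Rightarrow> ('x word \<times> 'x word) set \<Rightarrow> 'x word \<Rightarrow> 'x word \<Rightarrow> bool"
  for X R where
  refl: "w \<in> words X \<Longrightarrow> word_cong X R w w"
| sym: "word_cong X R u v \<Longrightarrow> word_cong X R v u"
| trans: "word_cong X R u v \<Longrightarrow> word_cong X R v w \<Longrightarrow> word_cong X R u w"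
| cancel: "u \<in> words X \<Longrightarrow> v \<in> words X \<Longrightarrow> x \<in> X \<Longrightarrow>
    word_cong X R (u @ [(x, e), (x, \<not> e)] @ v) (u @ v)"
| rel: "u \<in> words X \<Longrightarrow> v \<in> words X \<Longrightarrow> (l, r) \<in> R \<Longrightarrow>
    word_cong X R (u @ l @ v) (u @ r @ v)"

definition word_class :: "'x set \<Rightarrow> ('x word \<times> 'x word) set \<Rightarrow> 'x word \<Rightarrow> 'x word set" where
  "word_class X R w = {v. word_cong X R w v}"

text \<open>This is the intended group only if both sides of every relation in \<open>R\<close> are words over \<open>X\<close>.\<close>

definition presented_group :: "'x set \<Rightarrow> ('x word \<times> 'x word) set \<Rightarrow> 'x word set monoid" where
  "presented_group X R =
    \<lparr>carrier = word_class X R ` words X,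
     monoid.mult = (\<lambda>U V. \<Union>u\<in>U. \<Union>v\<in>V. word_class X R (u @ v)),
     one = word_class X R []\<rparr>"

lemma words_append [simp]: "u @ v \<in> words X \<longleftrightarrow> u \<in> words X \<and> v \<in> words X"
  by (auto simp: words_def)

lemma words_Nil [simp]: "[] \<in> words X"
  by (auto simp: words_def)

lemma words_gen [simp]: "gen x \<in> words X \<longleftrightarrow> x \<in> X"
  by (auto simp: words_def gen_def)

lemma inv_word_words [simp]: "inv_word w \<in> words X \<longleftrightarrow> w \<in> words X"
  by (induction w) (auto simp: words_def inv_word_def)

lemma comm_word_words [simp]: "comm_word u v \<in> words X \<longleftrightarrow> u \<in> words X \<and> v \<in> words X"
  by (auto simp: comm_word_def)

lemma word_cong_words:
  assumes "word_cong X R u v" "R \<subseteq> words X \<times> words X"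
  shows "u \<in> words X \<and> v \<in> words X"
  using assms by (induction rule: word_cong.induct) (auto simp: words_def)

lemma word_cong_context:
  assumes "word_cong X R u v" "s \<in> words X" "t \<in> words X"
  shows "word_cong X R (s @ u @ t) (s @ v @ t)"
  using assms(1)
proof (induction rule: word_cong.induct)
  case (refl w)
  then show ?case using assms by (intro word_cong.refl) auto
next
  case (cancel u v x e)
  then show ?case using word_cong.cancel[of "s @ u" X "v @ t" x R e] assms by simp
next
  case (rel u v l r)
  then show ?case using word_cong.rel[of "s @ u" X "v @ t" l r R] assms by simp
qed (blast intro: word_cong.sym word_cong.trans)+

lemma word_class_eq_iff:
  assumes "u \<in> words X"
  shows "word_class X R u = word_class X R v \<longleftrightarrow> word_cong X R u v"
proof
  assume "word_class X R u = word_class X R v"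
  with word_cong.refl[OF assms, of R] have "word_cong X R v u"
    by (auto simp: word_class_def)
  then show "word_cong X R u v" by (rule word_cong.sym)
next
  assume uv: "word_cong X R u v"
  show "word_class X R u = word_class X R v"
    unfolding word_class_def
    using word_cong.trans[OF uv] word_cong.trans[OF word_cong.sym[OF uv]] by blast
qed

lemma presented_group_mult:
  assumes R: "R \<subseteq> words X \<times> words X" and "u \<in> words X" "v \<in> words X"
  shows "word_class X R u \<otimes>\<^bsub>presented_group X R\<^esub> word_class X R v = word_class X R (u @ v)"
proof -
  have "word_class X R (u' @ v') = word_class X R (u @ v)"
    if "word_cong X R u u'" "word_cong X R v v'" for u' v'
  proof -
    have *: "u' \<in> words X" "v' \<in> words X"
      using word_cong_words[OF that(1) R] word_cong_words[OF that(2) R] by auto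
    have "word_cong X R (u @ v) (u' @ v)"
      using word_cong_context[OF that(1), of "[]" v] assms by simp
    moreover have "word_cong X R (u' @ v) (u' @ v')"
      using word_cong_context[OF that(2), of u' "[]"] * by simp
    ultimately have "word_cong X R (u @ v) (u' @ v')"
      by (rule word_cong.trans)
    then show ?thesis
      using word_class_eq_iff[of "u @ v" X R "u' @ v'"] assms by simp
  qed
  moreover have "u \<in> word_class X R u" "v \<in> word_class X R v"
    using assms by (auto simp: word_class_def intro: word_cong.refl)
  ultimately have "(\<Union>u'\<in>word_class X R u. \<Union>v'\<in>word_class X R v. word_class X R (u' @ v'))
      = word_class X R (u @ v)"
    unfolding word_class_def[of X R u] word_class_def[of X R v] by blast
  then show ?thesis
    by (simp add: presented_group_def)
qed

lemma inv_word_left_cancel: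
  assumes "w \<in> words X"
  shows "word_cong X R (inv_word w @ w) []"
  using assms
proof (induction w)
  case Nil
  then show ?case by (auto simp: inv_word_def intro: word_cong.refl)
next
  case (Cons a w)
  obtain x e where a: "a = (x, e)" by fastforce
  from Cons.prems have w: "w \<in> words X" "x \<in> X" by (auto simp: words_def a)
  have "word_cong X R (inv_word w @ [(x, \<not> e), (x, \<not> \<not> e)] @ w) (inv_word w @ w)"
    using w by (intro word_cong.cancel) auto
  then have "word_cong X R (inv_word (a # w) @ a # w) (inv_word w @ w)"
    by (simp add: a inv_word_def)
  with Cons.IH[OF w(1)] show ?case by (blast intro: word_cong.trans)
qed

lemma group_presented_group:
  assumes R: "R \<subseteq> words X \<times> words X"
  shows "group (presented_group X R)"
proof (rule groupI)
  note [simp] = presented_group_mult[OF R]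
  let ?P = "presented_group X R"
  have C: "carrier ?P = word_class X R ` words X" and O: "\<one>\<^bsub>?P\<^esub> = word_class X R []"
    by (simp_all add: presented_group_def)
  show "\<one>\<^bsub>?P\<^esub> \<in> carrier ?P" by (auto simp: C O)
  show "x \<otimes>\<^bsub>?P\<^esub> y \<in> carrier ?P" if "x \<in> carrier ?P" "y \<in> carrier ?P" for x y
    using that by (auto simp: C)
  show "x \<otimes>\<^bsub>?P\<^esub> y \<otimes>\<^bsub>?P\<^esub> z = x \<otimes>\<^bsub>?P\<^esub> (y \<otimes>\<^bsub>?P\<^esub> z)"
    if "x \<in> carrier ?P" "y \<in> carrier ?P" "z \<in> carrier ?P" for x y z
    using that by (auto simp: C)
  show "\<one>\<^bsub>?P\<^esub> \<otimes>\<^bsub>?P\<^esub> x = x" if "x \<in> carrier ?P" for x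
    using that by (auto simp: C O)
  show "\<exists>y\<in>carrier ?P. y \<otimes>\<^bsub>?P\<^esub> x = \<one>\<^bsub>?P\<^esub>" if x: "x \<in> carrier ?P" for x
  proof -
    from x obtain w where w: "w \<in> words X" "x = word_class X R w" by (auto simp: C)
    then have "word_class X R (inv_word w) \<otimes>\<^bsub>?P\<^esub> x = \<one>\<^bsub>?P\<^esub>"
      using inv_word_left_cancel[OF w(1), of R] word_class_eq_iff[of "inv_word w @ w" X R "[]"]
      by (simp add: O)
    with w show ?thesis by (auto simp: C)
  qed
qed


section \<open>The full braid group on two strings of a surface of genus \<open>g\<close>\<close>

datatype braid_gen = A nat | B nat | Sigma

definition braid_gens :: "nat \<Rightarrow> braid_gen set" where
  "braid_gens g = A ` {1..g} \<union> B ` {1..g} \<union> {Sigma}"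

definition braid_rels :: "nat \<Rightarrow> (braid_gen word \<times> braid_gen word) set" where
  "braid_rels g =
    (let a = (\<lambda>i. gen (A i)); b = (\<lambda>i. gen (B i)); s = gen Sigma; s' = inv_word s in
      {(comm_word (a i) (s' @ a i @ s'), []) | i. i \<in> {1..g}}
    \<union> {(comm_word (b i) (s' @ b i @ s'), []) | i. i \<in> {1..g}}
    \<union> {(comm_word (a i) (s' @ a j @ s), []) | i j. i \<in> {1..g} \<and> j \<in> {1..g} \<and> j < i}
    \<union> {(comm_word (a i) (s' @ b j @ s), []) | i j. i \<in> {1..g} \<and> j \<in> {1..g} \<and> j < i}
    \<union> {(comm_word (b i) (s' @ a j @ s), []) | i j. i \<in> {1..g} \<and> j \<in> {1..g} \<and> j < i}
    \<union> {(comm_word (b i) (s' @ b j @ s), []) | i j. i \<in> {1..g} \<and> j \<in> {1..g} \<and> j < i}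
    \<union> {(comm_word (a i) (s' @ b i @ s'), s @ s) | i. i \<in> {1..g}}
    \<union> {(concat (map (\<lambda>i. comm_word (a i) (inv_word (b i))) [1..<Suc g]), s @ s)})"

definition braid_group :: "nat \<Rightarrow> braid_gen word set monoid" where
  "braid_group g = presented_group (braid_gens g) (braid_rels g)"

definition braid_elt :: "nat \<Rightarrow> braid_gen \<Rightarrow> braid_gen word set" where
  "braid_elt g x = word_class (braid_gens g) (braid_rels g) (gen x)"

lemma braid_rels_words: "braid_rels g \<subseteq> words (braid_gens g) \<times> words (braid_gens g)"
proof -
  have "concat (map f xs) \<in> words X \<longleftrightarrow> (\<forall>i\<in>set xs. f i \<in> words X)"
    for f :: "nat \<Rightarrow> braid_gen word" and X xs
    by (induction xs) auto
  then show ?thesis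
    by (auto simp: braid_rels_def Let_def braid_gens_def simp del: upt_Suc)
qed

lemma group_braid_group: "group (braid_group g)"
  unfolding braid_group_def by (rule group_presented_group[OF braid_rels_words])


section \<open>Admissible quotients\<close>

definition admissible_epi ::
    "nat \<Rightarrow> ('a, 'm) monoid_scheme \<Rightarrow> (braid_gen word set \<Rightarrow> 'a) \<Rightarrow> bool" where
  "admissible_epi g G \<phi> \<longleftrightarrow>
    group G \<and> finite (carrier G) \<and> \<phi> \<in> epi (braid_group g) G \<and>
    2 \<le> group.ord G (\<phi> (braid_elt g Sigma))"

definition admissible_quotient :: "nat \<Rightarrow> ('a, 'm) monoid_scheme \<Rightarrow> bool" where
  "admissible_quotient g G \<longleftrightarrow> (\<exists>\<phi>. admissible_epi g G \<phi>)"

text \<open>The tuple \<open>(a\<^sub>1, b\<^sub>1, \<dots>, a\<^sub>g, b\<^sub>g, s)\<close> as a list of length \<open>2 * g + 1\<close>.\<close>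

definition gv_tuple :: "nat \<Rightarrow> (nat \<Rightarrow> 'a) \<Rightarrow> (nat \<Rightarrow> 'a) \<Rightarrow> 'a \<Rightarrow> 'a list" where
  "gv_tuple g a b s = concat (map (\<lambda>i. [a i, b i]) [1..<Suc g]) @ [s]"

definition generating_vectors :: "nat \<Rightarrow> ('a, 'm) monoid_scheme \<Rightarrow> 'a list set" where
  "generating_vectors g G =
    {gv_tuple g (\<lambda>i. \<phi> (braid_elt g (A i))) (\<lambda>i. \<phi> (braid_elt g (B i))) (\<phi> (braid_elt g Sigma))
      | \<phi>. admissible_epi g G \<phi>}"


section \<open>Extra-special groups\<close>

definition center :: "('a, 'm) monoid_scheme \<Rightarrow> 'a set" where
  "center G = {z \<in> carrier G. \<forall>x \<in> carrier G. x \<otimes>\<^bsub>G\<^esub> z = z \<otimes>\<^bsub>G\<^esub> x}"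

definition elementary_abelian :: "nat \<Rightarrow> ('a, 'm) monoid_scheme \<Rightarrow> bool" where
  "elementary_abelian p G \<longleftrightarrow>
    comm_group G \<and> finite (carrier G) \<and> (\<forall>x \<in> carrier G. x [^]\<^bsub>G\<^esub> p = \<one>\<^bsub>G\<^esub>)"

definition extra_special :: "nat \<Rightarrow> ('a, 'm) monoid_scheme \<Rightarrow> bool" where
  "extra_special p G \<longleftrightarrow>
    prime p \<and> group G \<and> finite (carrier G) \<and> (\<exists>k. order G = p ^ k) \<and>
    cyclic_group (G\<lparr>carrier := center G\<rparr>) \<and> card (center G) = p \<and>
    elementary_abelian p (G Mod center G) \<and> \<not> trivial_group (G Mod center G)"

end

theory Submission
  imports Defs
begin

text \<open>An epimorphism from the braid group onto \<open>G\<close> amounts to a choice of generators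
  \<open>a\<^sub>i\<close>, \<open>b\<^sub>i\<close>, \<open>s\<close> of \<open>G\<close> satisfying the relations. In an extra-special 2-group with centre
  \<open>{1, z}\<close> every commutator is \<open>1\<close> or \<open>z\<close> and depends only on the classes modulo the centre. It is
  a bilinear form on \<open>G / {1, z}\<close>, regarded as a vector space over the field with two elements
  (\<open>commutes_mult\<close>). Conjugating an argument, or multiplying it by
  \<open>s\<^sup>-\<^sup>1\<close> on both sides, changes its class by a multiple of \<open>2\<close>, that is, not at all. The relations
  therefore collapse (\<open>respects_braid_rels_iff\<close>): generators with different indices commute,
  \<open>[a\<^sub>i, b\<^sub>i] = s\<^sup>2\<close> for every \<open>i\<close>, and the surface relation becomes \<open>(s\<^sup>2)\<^sup>g = s\<^sup>2\<close>. As \<open>s\<^sup>2\<close> is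
  \<open>1\<close> or \<open>z\<close>, the last equation says that \<open>s\<^sup>2 = 1\<close> or \<open>g\<close> is odd.

  If \<open>s\<^sup>2 = 1\<close>, all the \<open>a\<^sub>i\<close> and \<open>b\<^sub>i\<close> commute with each other, so they span an isotropic subspace
  that together with the single vector \<open>s\<close> spans everything. Nondegeneracy of the form then bounds
  the dimension by \<open>2\<close>, hence the order of \<open>G\<close> by \<open>8\<close> (\<open>card_le_8_if_commuting_generators\<close>), whereas
  it is at least \<open>32\<close> for \<open>g \<ge> 2\<close>. So \<open>s\<^sup>2 = z\<close> and \<open>g\<close> is odd.

  Conversely, let \<open>g\<close> be odd. Lifts \<open>a\<^sub>i\<close>, \<open>b\<^sub>i\<close> of a symplectic basis (\<open>symplectic_basis\<close>) generate
  \<open>G\<close> modulo the centre and satisfy \<open>[a\<^sub>i, b\<^sub>i] = z\<close>. Any \<open>s\<close> with \<open>s\<^sup>2 = z\<close> completes them to a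
  generating vector; such an \<open>s\<close> exists because a group in which all squares are trivial is
  abelian.\<close>

section \<open>Homomorphisms out of a presented group\<close>

primrec eval_word :: "('a, 'm) monoid_scheme \<Rightarrow> ('x \<Rightarrow> 'a) \<Rightarrow> 'x word \<Rightarrow> 'a" where
  "eval_word G f [] = \<one>\<^bsub>G\<^esub>"
| "eval_word G f (c # w) =
    (if snd c then f (fst c) else inv\<^bsub>G\<^esub> f (fst c)) \<otimes>\<^bsub>G\<^esub> eval_word G f w"

context group
begin

lemma eval_word_closed:
  assumes "f \<in> X \<rightarrow> carrier G" "w \<in> words X"
  shows "eval_word G f w \<in> carrier G"
  using assms(2)
proof (induction w)
  case (Cons c w)
  then have "w \<in> words X" "fst c \<in> X" by (auto simp: words_def)
  moreover have "f (fst c) \<in> carrier G" using calculation assms(1) by blast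
  ultimately show ?case using Cons.IH by simp
qed simp

lemma eval_word_append:
  assumes "f \<in> X \<rightarrow> carrier G" "u \<in> words X" "v \<in> words X"
  shows "eval_word G f (u @ v) = eval_word G f u \<otimes> eval_word G f v"
  using assms(2)
proof (induction u)
  case Nil
  then show ?case using eval_word_closed[OF assms(1,3)] by simp
next
  case (Cons c u)
  then have "u \<in> words X" "fst c \<in> X" by (auto simp: words_def)
  moreover have "f (fst c) \<in> carrier G" using calculation assms(1) by blast
  ultimately show ?case
    using Cons.IH eval_word_closed[OF assms(1)] assms(3) by (simp add: m_assoc)
qed

lemma eval_word_gen:
  assumes "f \<in> X \<rightarrow> carrier G" "x \<in> X"
  shows "eval_word G f (gen x) = f x"
  using funcset_mem[OF assms] by (simp add: gen_def)

lemma eval_word_inv_word: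
  assumes "f \<in> X \<rightarrow> carrier G" "w \<in> words X"
  shows "eval_word G f (inv_word w) = inv (eval_word G f w)"
  using assms(2)
proof (induction w)
  case Nil
  then show ?case by (simp add: inv_word_def)
next
  case (Cons c w)
  then have w: "w \<in> words X" and c: "fst c \<in> X" by (auto simp: words_def)
  let ?c = "[(fst c, \<not> snd c)]"
  have fc: "f (fst c) \<in> carrier G" using c assms(1) by blast
  have "inv_word (c # w) = inv_word w @ ?c"
    by (simp add: inv_word_def split: prod.split)
  moreover have "?c \<in> words X" using c by (simp add: words_def)
  ultimately have "eval_word G f (inv_word (c # w)) = inv (eval_word G f w) \<otimes> eval_word G f ?c"
    using Cons.IH[OF w] w eval_word_append[OF assms(1)] by simp
  also have "eval_word G f ?c = inv (if snd c then f (fst c) else inv (f (fst c)))"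
    using fc by simp
  finally show ?case
    using fc eval_word_closed[OF assms(1) w] by (simp add: inv_mult_group)
qed

lemma eval_word_comm_word:
  assumes "f \<in> X \<rightarrow> carrier G" "u \<in> words X" "v \<in> words X"
  shows "eval_word G f (comm_word u v) =
    eval_word G f u \<otimes> eval_word G f v \<otimes> inv (eval_word G f u) \<otimes> inv (eval_word G f v)"
  using assms eval_word_closed[OF assms(1)]
  by (simp add: comm_word_def eval_word_append[OF assms(1)] eval_word_inv_word[OF assms(1)] m_assoc)

lemma eval_word_image_words:
  assumes "f \<in> X \<rightarrow> carrier G"
  shows "eval_word G f ` words X = generate G (f ` X)"
proof
  have "eval_word G f w \<in> generate G (f ` X)" if "w \<in> words X" for w
    using that
  proof (induction w)
    case (Cons c w)
    then have "w \<in> words X" "fst c \<in> X" by (auto simp: words_def)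
    then show ?case
      using Cons.IH generate.incl[of "f (fst c)" "f ` X" G] generate.inv[of "f (fst c)" "f ` X" G]
      by (auto intro: generate.eng)
  qed (simp add: generate.one)
  then show "eval_word G f ` words X \<subseteq> generate G (f ` X)" by blast
next
  have "y \<in> eval_word G f ` words X" if "y \<in> generate G (f ` X)" for y
    using that
  proof (induction rule: generate.induct)
    case one
    have "\<one> = eval_word G f []" by simp
    then show ?case using words_Nil by blast
  next
    case (incl h)
    then obtain x where "x \<in> X" "h = f x" by blast
    then have "h = eval_word G f (gen x)" "gen x \<in> words X"
      using eval_word_gen[OF assms] by auto
    then show ?case by blast
  next
    case (inv h)
    then obtain x where "x \<in> X" "h = f x" by blast
    then have "inv h = eval_word G f (inv_word (gen x))" "inv_word (gen x) \<in> words X"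
      using eval_word_gen[OF assms] eval_word_inv_word[OF assms] by auto
    then show ?case by blast
  next
    case (eng h k)
    then obtain u v where "u \<in> words X" "v \<in> words X" "h = eval_word G f u" "k = eval_word G f v"
      by blast
    then have "h \<otimes> k = eval_word G f (u @ v)" "u @ v \<in> words X"
      using eval_word_append[OF assms] by auto
    then show ?case by blast
  qed
  then show "generate G (f ` X) \<subseteq> eval_word G f ` words X" by blast
qed

lemma eval_word_cong:
  assumes f: "f \<in> X \<rightarrow> carrier G" and R: "R \<subseteq> words X \<times> words X"
    and rels: "\<And>l r. (l, r) \<in> R \<Longrightarrow> eval_word G f l = eval_word G f r"
    and "word_cong X R u v"
  shows "eval_word G f u = eval_word G f v"
  using assms(4)
proof (induction rule: word_cong.induct)
  case (cancel u v x e)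
  have fx: "f x \<in> carrier G" using f cancel by blast
  have "[(x, e), (x, \<not> e)] \<in> words X" using cancel by (simp add: words_def)
  moreover have "eval_word G f [(x, e), (x, \<not> e)] = \<one>" using fx by simp
  ultimately show ?case
    using cancel eval_word_closed[OF f] by (simp add: eval_word_append[OF f] del: append_Cons eval_word.simps)
next
  case (rel u v l r)
  then have "l \<in> words X" "r \<in> words X" using R by auto
  then show ?case using rel rels by (simp add: eval_word_append[OF f])
qed simp_all

text \<open>The map is well defined on classes because evaluation respects each elementary move of
  \<^const>\<open>word_cong\<close>, so any representative of a class may be used.\<close>

lemma presented_group_universal:
  assumes f: "f \<in> X \<rightarrow> carrier G" and R: "R \<subseteq> words X \<times> words X"
    and rels: "\<And>l r. (l, r) \<in> R \<Longrightarrow> eval_word G f l = eval_word G f r"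
  obtains \<phi> where "\<phi> \<in> hom (presented_group X R) G"
    and "\<And>w. w \<in> words X \<Longrightarrow> \<phi> (word_class X R w) = eval_word G f w"
proof
  let ?\<phi> = "\<lambda>U. eval_word G f (SOME w. w \<in> U)"
  show eval: "?\<phi> (word_class X R w) = eval_word G f w" if "w \<in> words X" for w
  proof -
    have "w \<in> word_class X R w" using that by (simp add: word_class_def word_cong.refl)
    then have "(SOME u. u \<in> word_class X R w) \<in> word_class X R w" by (rule someI)
    then have "word_cong X R w (SOME u. u \<in> word_class X R w)"
      unfolding word_class_def by simp
    then show ?thesis using eval_word_cong[OF f R rels] by metis
  qed
  have carr: "carrier (presented_group X R) = word_class X R ` words X"
    by (simp add: presented_group_def)
  show "?\<phi> \<in> hom (presented_group X R) G"
  proof (rule homI)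
    fix U assume "U \<in> carrier (presented_group X R)"
    then show "?\<phi> U \<in> carrier G" using eval eval_word_closed[OF f] unfolding carr by auto
  next
    fix U V assume "U \<in> carrier (presented_group X R)" "V \<in> carrier (presented_group X R)"
    then obtain u v where uv: "u \<in> words X" "v \<in> words X"
      "U = word_class X R u" "V = word_class X R v" unfolding carr by blast
    have "?\<phi> (word_class X R (u @ v)) = eval_word G f u \<otimes> eval_word G f v"
      using uv eval[of "u @ v"] eval_word_append[OF f] by simp
    then show "?\<phi> (U \<otimes>\<^bsub>presented_group X R\<^esub> V) = ?\<phi> U \<otimes> ?\<phi> V"
      using uv presented_group_mult[OF R] eval by simp
  qed
qed

text \<open>A homomorphism out of a presented group is determined by its values on the generators; the only
  point beyond multiplicativity is that the class of a negative letter is the inverse of the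
  class of the generator.\<close>

lemma hom_presented_group_eq_eval_word:
  assumes \<phi>: "\<phi> \<in> hom (presented_group X R) G" and R: "R \<subseteq> words X \<times> words X"
    and "w \<in> words X"
  shows "\<phi> (word_class X R w) = eval_word G (\<lambda>x. \<phi> (word_class X R (gen x))) w"
  using assms(3)
proof (induction w)
  let ?P = "presented_group X R"
  interpret P: group ?P by (rule group_presented_group[OF R])
  interpret h: group_hom ?P G \<phi> by unfold_locales (use \<phi> in auto)
  have one: "word_class X R [] = \<one>\<^bsub>?P\<^esub>" by (simp add: presented_group_def)
  have cl: "word_class X R w \<in> carrier ?P" if "w \<in> words X" for w
    using that by (simp add: presented_group_def)
  {
    case Nil
    show ?case using h.hom_one by (simp add: one)
  next
    case (Cons c w)
    obtain x e where c: "c = (x, e)" by fastforce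
    from Cons have w: "w \<in> words X" and x: "x \<in> X" by (auto simp: words_def c)
    have c_word: "[c] \<in> words X" using x by (simp add: words_def c)
    have "\<phi> (word_class X R [c]) = (if e then \<phi> (word_class X R (gen x)) else inv \<phi> (word_class X R (gen x)))"
    proof (cases e)
      case False
      have "[c] = inv_word (gen x)" using False by (simp add: inv_word_def gen_def c)
      then have "word_cong X R ([c] @ gen x) []"
        using inv_word_left_cancel[of "gen x"] x by simp
      then have "word_class X R ([c] @ gen x) = word_class X R []"
        using word_class_eq_iff[of "[c] @ gen x" X R "[]"] c_word x by (simp del: append_Cons)
      then have "word_class X R [c] \<otimes>\<^bsub>?P\<^esub> word_class X R (gen x) = \<one>\<^bsub>?P\<^esub>"
        using presented_group_mult[OF R c_word] x one by simp
      then have "word_class X R [c] = inv\<^bsub>?P\<^esub> word_class X R (gen x)"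
        using cl c_word x by (intro P.inv_equality[symmetric]) auto
      then show ?thesis using False x cl by simp
    qed (simp add: c gen_def)
    moreover have "word_class X R (c # w) = word_class X R [c] \<otimes>\<^bsub>?P\<^esub> word_class X R w"
      using presented_group_mult[OF R c_word w] by simp
    ultimately show ?case
      using Cons.IH[OF w] cl c_word w by (simp add: c)
  }
qed

lemma hom_presented_group_respects:
  assumes \<phi>: "\<phi> \<in> hom (presented_group X R) G" and R: "R \<subseteq> words X \<times> words X"
    and lr: "(l, r) \<in> R"
  shows "eval_word G (\<lambda>x. \<phi> (word_class X R (gen x))) l
    = eval_word G (\<lambda>x. \<phi> (word_class X R (gen x))) r"
proof -
  have "l \<in> words X" "r \<in> words X" using R lr by auto
  moreover have "word_cong X R l r" using word_cong.rel[of "[]" X "[]" l r R] lr by simp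
  ultimately show ?thesis
    using word_class_eq_iff[of l X R r] hom_presented_group_eq_eval_word[OF \<phi> R] by metis
qed

end


section \<open>Commutation in an extra-special 2-group\<close>

text \<open>The data carried by \<open>G\<close> over the vector space \<open>V = G / {\<one>, z}\<close>: \<open>swap\<close> is the alternating form
  given by commutators, \<open>square\<close> the quadratic form given by squares, both with values in
  \<open>{\<one>, z}\<close>, and \<open>center_eq\<close> says that the alternating form is nondegenerate.\<close>

locale extra_special_2_group = group G for G (structure) +
  fixes z
  assumes finite_carrier: "finite (carrier G)"
    and center_eq: "center G = {\<one>, z}" and z_neq_one: "z \<noteq> \<one>"
    and swap: "x \<in> carrier G \<Longrightarrow> y \<in> carrier G \<Longrightarrow> x \<otimes> y = y \<otimes> x \<or> x \<otimes> y = z \<otimes> (y \<otimes> x)"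
    and square: "x \<in> carrier G \<Longrightarrow> x \<otimes> x = \<one> \<or> x \<otimes> x = z"

lemma extra_special_2_groupI:
  fixes G (structure)
  assumes G: "extra_special 2 G" and z: "z \<in> carrier G" and cz: "center G = generate G {z}"
  shows "extra_special_2_group G z"
proof -
  interpret group G using G by (simp add: extra_special_def)
  let ?C = "center G"
  have sub: "subgroup ?C G" unfolding cz using z by (intro generate_is_subgroup) auto
  have fin: "finite (carrier G)" and c2: "card ?C = 2"
    and ea: "elementary_abelian 2 (G Mod ?C)" using G by (auto simp: extra_special_def)
  have "z \<noteq> \<one>"
  proof
    assume "z = \<one>"
    then have "?C = {\<one>}" unfolding cz by (simp add: generate_one)
    then show False using c2 by simp
  qed
  moreover have "\<one> \<in> ?C" using sub by (simp add: subgroup.one_closed)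
  moreover have "z \<in> ?C" unfolding cz by (simp add: generate.incl)
  ultimately have Ceq: "?C = {\<one>, z}"
    using c2 by (metis card_2_iff insert_iff singletonD doubleton_eq_iff)
  \<comment> \<open>The two laws are the statements that \<open>G / Z\<close> is abelian and of exponent 2, read back in \<open>G\<close>.\<close>
  have nor: "?C \<lhd> G"
  proof (rule normalI[OF sub], rule ballI)
    fix x assume "x \<in> carrier G"
    then show "?C #> x = x <# ?C"
      unfolding r_coset_def l_coset_def by (auto simp: center_def)
  qed
  interpret N: normal ?C G by (rule nor)
  interpret Q: comm_group "G Mod ?C" using ea by (simp add: elementary_abelian_def)
  have coset_mem: "\<exists>c\<in>?C. x = c \<otimes> y" if "?C #> x = ?C #> y" "x \<in> carrier G" for x y
    using rcos_self[OF that(2) sub] that(1) by (auto simp: r_coset_def)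
  have coset_carr: "?C #> x \<in> carrier (G Mod ?C)" if "x \<in> carrier G" for x
    using that by (auto simp: FactGroup_def RCOSETS_def)
  have coset_mult: "(?C #> x) \<otimes>\<^bsub>G Mod ?C\<^esub> (?C #> y) = ?C #> (x \<otimes> y)"
    if "x \<in> carrier G" "y \<in> carrier G" for x y
    using that N.rcos_sum by (simp add: FactGroup_def)
  show ?thesis
  proof unfold_locales
    show "finite (carrier G)" by fact
    show "?C = {\<one>, z}" by fact
    show "z \<noteq> \<one>" by fact
    fix x assume x: "x \<in> carrier G"
    have "(?C #> x) [^]\<^bsub>G Mod ?C\<^esub> (2::nat) = \<one>\<^bsub>G Mod ?C\<^esub>"
      using ea coset_carr[OF x] by (simp add: elementary_abelian_def)
    moreover have "(?C #> x) [^]\<^bsub>G Mod ?C\<^esub> (2::nat) = (?C #> x) \<otimes>\<^bsub>G Mod ?C\<^esub> (?C #> x)"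
      unfolding numeral_2_eq_2 using Q.l_one[OF coset_carr[OF x]] by simp
    ultimately have "?C #> (x \<otimes> x) = ?C #> \<one>"
      using coset_mult[OF x x] coset_mult_one[OF N.subset] by simp
    then show "x \<otimes> x = \<one> \<or> x \<otimes> x = z"
      using coset_mem[of "x \<otimes> x" \<one>] x z Ceq by auto
    fix y assume y: "y \<in> carrier G"
    have "?C #> (x \<otimes> y) = ?C #> (y \<otimes> x)"
      using Q.m_comm[OF coset_carr[OF x] coset_carr[OF y]] coset_mult x y by simp
    then show "x \<otimes> y = y \<otimes> x \<or> x \<otimes> y = z \<otimes> (y \<otimes> x)"
      using coset_mem[of "x \<otimes> y" "y \<otimes> x"] x y Ceq by auto
  qed
qed

context extra_special_2_group
begin

definition commutes :: "'a \<Rightarrow> 'a \<Rightarrow> bool" where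
  "commutes x y \<longleftrightarrow> x \<otimes> y = y \<otimes> x"

lemma commutes_sym: "commutes x y \<longleftrightarrow> commutes y x"
  by (auto simp: commutes_def)

lemma commutes_refl [simp]: "commutes x x"
  by (simp add: commutes_def)

lemma z_closed [simp]: "z \<in> carrier G"
  using center_eq by (auto simp: center_def)

lemma commutes_z [simp]: "x \<in> carrier G \<Longrightarrow> commutes x z"
  using center_eq by (auto simp: center_def commutes_def)

lemma commutes_one [simp]: "x \<in> carrier G \<Longrightarrow> commutes x \<one>"
  by (simp add: commutes_def)

lemma mem_center_iff: "x \<in> {\<one>, z} \<longleftrightarrow> x \<in> carrier G \<and> (\<forall>y\<in>carrier G. commutes x y)"
proof -
  have "x \<in> center G \<longleftrightarrow> x \<in> carrier G \<and> (\<forall>y\<in>carrier G. commutes x y)"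
    by (auto simp: center_def commutes_def)
  then show ?thesis unfolding center_eq .
qed

lemma z_square [simp]: "z \<otimes> z = \<one>"
  using square[of z] z_neq_one by (metis l_cancel_one z_closed)

lemma swap_eq: "\<lbrakk>x \<in> carrier G; y \<in> carrier G; \<not> commutes x y\<rbrakk> \<Longrightarrow> x \<otimes> y = z \<otimes> (y \<otimes> x)"
  using swap commutes_def by metis

lemma z_left_commute: "\<lbrakk>x \<in> carrier G; y \<in> carrier G\<rbrakk> \<Longrightarrow> x \<otimes> (z \<otimes> y) = z \<otimes> (x \<otimes> y)"
  using commutes_z[of x] by (simp add: commutes_def flip: m_assoc)

lemma z_mult_neq: "x \<in> carrier G \<Longrightarrow> z \<otimes> x \<noteq> x"
  using z_neq_one by simp

text \<open>Bilinearity of the commutator form, written additively in the truth values of \<^const>\<open>commutes\<close>: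
  moving \<open>b\<close> past \<open>x \<otimes> y\<close> produces one factor \<open>z\<close> for each of \<open>x\<close> and \<open>y\<close> that does not commute
  with \<open>b\<close>, and two such factors cancel.\<close>

lemma commutes_mult:
  assumes "b \<in> carrier G" "x \<in> carrier G" "y \<in> carrier G"
  shows "commutes b (x \<otimes> y) \<longleftrightarrow> (commutes b x \<longleftrightarrow> commutes b y)"
proof -
  \<comment> \<open>the commutator of \<open>b\<close> with \<open>u\<close>\<close>
  define c where "c u = (if commutes b u then \<one> else z)" for u
  have c: "b \<otimes> u = c u \<otimes> (u \<otimes> b)" if "u \<in> carrier G" for u
    using that assms swap_eq[of b u] by (auto simp: c_def commutes_def)
  have "b \<otimes> (x \<otimes> y) = c x \<otimes> (x \<otimes> (b \<otimes> y))"
    using c[OF assms(2)] assms by (simp add: c_def flip: m_assoc)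
  also have "\<dots> = c x \<otimes> (c y \<otimes> (x \<otimes> y \<otimes> b))"
    using c[OF assms(3)] assms by (simp add: c_def m_assoc z_left_commute)
  finally show ?thesis
    using assms z_mult_neq[of "x \<otimes> y \<otimes> b"]
    by (auto simp: commutes_def[of b "x \<otimes> y"] c_def simp flip: m_assoc[of z z] split: if_splits)
qed

lemma commutes_inv:
  assumes "b \<in> carrier G" "x \<in> carrier G"
  shows "commutes b (inv x) \<longleftrightarrow> commutes b x"
  using commutes_mult[of b x "inv x"] assms by simp

lemma commutator_eq:
  assumes "x \<in> carrier G" "y \<in> carrier G"
  shows "x \<otimes> y \<otimes> inv x \<otimes> inv y = (if commutes x y then \<one> else z)"
proof -
  have "x \<otimes> y = (if commutes x y then \<one> else z) \<otimes> (y \<otimes> x)"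
    using assms swap_eq by (auto simp: commutes_def)
  then show ?thesis using assms by (auto simp: m_assoc)
qed

lemma commutes_generate:
  assumes "y \<in> carrier G" "S \<subseteq> carrier G" "\<And>x. x \<in> S \<Longrightarrow> commutes y x" "x \<in> generate G S"
  shows "commutes y x"
  using assms(4)
proof (induction rule: generate.induct)
  case (eng h k)
  then show ?case using commutes_mult generate_in_carrier[OF assms(2)] assms(1) by blast
qed (use assms commutes_inv in auto)

section \<open>Centralizers and symplectic bases\<close>

text \<open>Translation by \<open>t\<close> exchanges the elements of \<open>H\<close> that commute with \<open>b\<close> and those that do not, so
  each kind makes up half of \<open>H\<close>.\<close>

lemma card_commutant:
  assumes "subgroup H G" "t \<in> H" "b \<in> carrier G" "\<not> commutes b t"
  shows "card H = 2 * card {x \<in> H. commutes b x}"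
proof -
  interpret H: subgroup H G by fact
  let ?P = "{x \<in> H. commutes b x}" and ?Q = "{x \<in> H. \<not> commutes b x}"
  have finH: "finite H" using finite_carrier H.subset finite_subset by blast
  have "bij_betw (\<lambda>x. t \<otimes> x) ?P ?Q"
  proof (rule bij_betw_byWitness[where f' = "\<lambda>x. inv t \<otimes> x"])
    show "\<forall>x\<in>?P. inv t \<otimes> (t \<otimes> x) = x"
      using assms(2) H.mem_carrier by (simp add: inv_solve_left')
    show "\<forall>x\<in>?Q. t \<otimes> (inv t \<otimes> x) = x"
      using assms(2) H.mem_carrier by (simp flip: m_assoc)
    show "(\<lambda>x. t \<otimes> x) ` ?P \<subseteq> ?Q" "(\<lambda>x. inv t \<otimes> x) ` ?Q \<subseteq> ?P"
      using assms H.mem_carrier by (auto simp: commutes_mult commutes_inv)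
  qed
  then have "card ?P = card ?Q" by (rule bij_betw_same_card)
  moreover have "card H = card ?P + card ?Q"
    using finH by (subst card_Un_disjoint[symmetric]) (auto intro: arg_cong[where f = card])
  ultimately show ?thesis by simp
qed

lemma subgroup_commutant:
  assumes "subgroup H G" "b \<in> carrier G"
  shows "subgroup {x \<in> H. commutes b x} G"
proof -
  interpret H: subgroup H G by fact
  show ?thesis
  proof (rule subgroupI)
    show "{x \<in> H. commutes b x} \<noteq> {}"
      using H.one_closed commutes_one[OF assms(2)] by blast
  qed (use assms in \<open>auto simp: commutes_mult commutes_inv\<close>)
qed

lemma card_commutant_pair:
  assumes H: "subgroup H G" and xy: "x \<in> H" "y \<in> H" "\<not> commutes x y"
  shows "card H = 4 * card {h \<in> H. commutes x h \<and> commutes y h}"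
proof -
  interpret H: subgroup H G by fact
  let ?K = "{h \<in> H. commutes x h}"
  have "card H = 2 * card ?K" using card_commutant[OF H xy(2) _ xy(3)] xy(1) by simp
  moreover have "card ?K = 2 * card {h \<in> ?K. commutes y h}"
    using card_commutant[OF subgroup_commutant[OF H], of x x y] xy commutes_sym[of x y] by simp
  moreover have "{h \<in> ?K. commutes y h} = {h \<in> H. commutes x h \<and> commutes y h}" by auto
  ultimately show ?thesis by simp
qed

text \<open>The hyperbolic plane spanned by a noncommuting pair splits off: the commutators of \<open>h\<close> with \<open>x\<close>
  and \<open>y\<close> can be corrected independently by multiplying by \<open>y\<close> and \<open>x\<close> respectively.\<close>

lemma commutant_pair_decompose:
  assumes H: "subgroup H G" and xy: "x \<in> H" "y \<in> H" "\<not> commutes x y" and h: "h \<in> H"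
  obtains e where "e \<in> {\<one>, x, y, x \<otimes> y}" "e \<otimes> h \<in> {h \<in> H. commutes x h \<and> commutes y h}"
proof -
  interpret H: subgroup H G by fact
  have "\<not> commutes y x" using xy commutes_sym by blast
  then show thesis
    using that[of \<one>] that[of x] that[of y] that[of "x \<otimes> y"] xy h
    by (simp add: commutes_mult) (metis H.m_closed H.mem_carrier commutes_mult)
qed

text \<open>A symplectic basis is built by splitting off one hyperbolic plane at a time. For the induction the
  ambient group is replaced by a subgroup \<open>H\<close> on which the form is still nondegenerate (the last
  hypothesis); the elements of \<open>H\<close> orthogonal to a noncommuting pair form such a
  subgroup again, with a quarter of the elements.\<close>

lemma symplectic_basis:
  assumes "subgroup H G" "z \<in> H" "card H = 2 ^ (2 * m + 1)"
    and "\<And>u. u \<in> H \<Longrightarrow> (\<And>v. v \<in> H \<Longrightarrow> commutes u v) \<Longrightarrow> u \<in> {\<one>, z}"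
  shows "\<exists>a b. a ` {1..m} \<subseteq> H \<and> b ` {1..m} \<subseteq> H
    \<and> (\<forall>i\<in>{1..m}. \<forall>j\<in>{1..m}. commutes (a i) (a j) \<and> commutes (b i) (b j)
        \<and> (commutes (a i) (b j) \<longleftrightarrow> i \<noteq> j))
    \<and> H \<subseteq> generate G ({z} \<union> a ` {1..m} \<union> b ` {1..m})"
  using assms
proof (induction m arbitrary: H)
  case 0
  interpret H: subgroup H G by fact
  have "card {\<one>, z} = 2" using z_neq_one by simp
  moreover have "finite H" using finite_carrier H.subset finite_subset by blast
  ultimately have "H = {\<one>, z}" using 0 by (intro card_subset_eq[symmetric]) auto
  then show ?case by (auto intro: generate.one generate.incl)
next
  case (Suc m)
  interpret H: subgroup H G by fact
  have "\<not> H \<subseteq> {\<one>, z}"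
  proof
    assume "H \<subseteq> {\<one>, z}"
    then have "card H \<le> card {\<one>, z}" by (rule card_mono[rotated]) simp
    also have "\<dots> = 2 ^ 1" using z_neq_one by simp
    also have "\<dots> < (2::nat) ^ (2 * Suc m + 1)" by (rule power_strict_increasing) auto
    finally show False using Suc.prems(3) by simp
  qed
  then obtain x where x: "x \<in> H" "x \<notin> {\<one>, z}" by blast
  with Suc.prems(4) obtain y where y: "y \<in> H" and nxy: "\<not> commutes x y" by blast
  have nyx: "\<not> commutes y x" using nxy commutes_sym by blast
  define K where "K = {h \<in> H. commutes x h \<and> commutes y h}"
  note decompose = commutant_pair_decompose[OF H.subgroup_axioms x(1) y nxy, folded K_def]
  have "K = {h \<in> {h \<in> H. commutes x h}. commutes y h}" by (auto simp: K_def)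
  then have subK: "subgroup K G"
    using subgroup_commutant[OF subgroup_commutant[OF H.subgroup_axioms]] x y by simp
  have KH: "K \<subseteq> H" by (auto simp: K_def)
  have "z \<in> K" using Suc.prems(2) x y by (simp add: K_def)
  moreover have "card K = 2 ^ (2 * m + 1)"
    using card_commutant_pair[OF H.subgroup_axioms x(1) y nxy] Suc.prems(3) by (simp add: K_def)
  moreover have "u \<in> {\<one>, z}" if u: "u \<in> K" and uK: "\<And>v. v \<in> K \<Longrightarrow> commutes u v" for u
  proof (rule Suc.prems(4))
    show "u \<in> H" using u KH by blast
    have ux: "commutes u x" "commutes u y" using u commutes_sym by (auto simp: K_def)
    have uc: "u \<in> carrier G" using u KH by auto
    \<comment> \<open>\<open>u\<close> commutes with the plane spanned by \<open>x\<close> and \<open>y\<close> and with its complement \<open>K\<close>\<close>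
    fix h assume h: "h \<in> H"
    obtain e where e: "e \<in> {\<one>, x, y, x \<otimes> y}" "e \<otimes> h \<in> K" using decompose[OF h] .
    have ec: "e \<in> carrier G" and "commutes u e" using e(1) x y ux uc by (auto simp: commutes_mult)
    with uK[OF e(2)] show "commutes u h" using h uc by (simp add: commutes_mult)
  qed
  ultimately obtain a b where ab: "a ` {1..m} \<subseteq> K" "b ` {1..m} \<subseteq> K"
    and rel: "\<And>i j. \<lbrakk>i \<in> {1..m}; j \<in> {1..m}\<rbrakk> \<Longrightarrow> commutes (a i) (a j) \<and> commutes (b i) (b j)
        \<and> (commutes (a i) (b j) \<longleftrightarrow> i \<noteq> j)"
    and gen: "K \<subseteq> generate G ({z} \<union> a ` {1..m} \<union> b ` {1..m})"
    using Suc.IH[OF subK] by metis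
  define a' where "a' = a(Suc m := x)"
  define b' where "b' = b(Suc m := y)"
  have img: "a' ` {1..Suc m} = insert x (a ` {1..m})" "b' ` {1..Suc m} = insert y (b ` {1..m})"
    by (auto simp: a'_def b'_def atLeastAtMostSuc_conv)
  let ?S = "{z} \<union> a' ` {1..Suc m} \<union> b' ` {1..Suc m}"
  have S: "?S \<subseteq> carrier G" unfolding img using ab KH x y H.subset by auto
  have subS: "subgroup (generate G ?S) G" using S by (rule generate_is_subgroup)
  have KS: "K \<subseteq> generate G ?S"
    using gen mono_generate[of "{z} \<union> a ` {1..m} \<union> b ` {1..m}" ?S] unfolding img by blast
  have xS: "x \<in> generate G ?S" "y \<in> generate G ?S"
    unfolding img by (auto intro: generate.incl)
  have "H \<subseteq> generate G ?S"
  proof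
    fix h assume h: "h \<in> H"
    obtain e where e: "e \<in> {\<one>, x, y, x \<otimes> y}" "e \<otimes> h \<in> K" using decompose[OF h] .
    have ec: "e \<in> carrier G" using e(1) x y by auto
    have "e \<in> generate G ?S"
      using e(1) xS subgroup.m_closed[OF subS] subgroup.one_closed[OF subS] by blast
    then have "inv e \<otimes> (e \<otimes> h) \<in> generate G ?S"
      using e(2) KS subgroup.m_closed[OF subS] subgroup.m_inv_closed[OF subS] by blast
    then show "h \<in> generate G ?S" using ec h by (simp flip: m_assoc)
  qed
  moreover have "a' ` {1..Suc m} \<subseteq> H" "b' ` {1..Suc m} \<subseteq> H"
    unfolding img using ab KH x y by auto
  moreover have "commutes (a' i) (a' j) \<and> commutes (b' i) (b' j) \<and> (commutes (a' i) (b' j) \<longleftrightarrow> i \<noteq> j)"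
    if "i \<in> {1..Suc m}" "j \<in> {1..Suc m}" for i j
  proof -
    have K: "commutes x (a k)" "commutes x (b k)" "commutes y (a k)" "commutes y (b k)"
      if "k \<in> {1..m}" for k using ab that unfolding K_def by blast+
    have K': "commutes (a k) x" "commutes (b k) x" "commutes (a k) y" "commutes (b k) y"
      if "k \<in> {1..m}" for k using K[OF that] commutes_sym by blast+
    have "i \<in> {1..m} \<or> i = Suc m" "j \<in> {1..m} \<or> j = Suc m" using that by auto
    then show ?thesis
      using rel[of i j] K[of j] K'[of i] nxy nyx by (auto simp: a'_def b'_def)
  qed
  ultimately show ?case by (intro exI[of _ a'] exI[of _ b'] conjI ballI) auto
qed


section \<open>The braid relations in an extra-special 2-group\<close>

text \<open>These are the shapes in which commutators occur in the braid relations. Modulo the centre,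
  conjugation is trivial, every element is its own inverse, and two factors \<open>t\<^sup>-\<^sup>1\<close> cancel, so each
  of them evaluates to the plain commutator of the images of \<open>x\<close> and \<open>y\<close>.\<close>

lemma eval_word_comm_word_conj:
  assumes f: "f \<in> X \<rightarrow> carrier G" and X: "x \<in> X" "y \<in> X" "t \<in> X"
  shows "eval_word G f (comm_word (gen x) (inv_word (gen t) @ gen y @ gen t)) =
      (if commutes (f x) (f y) then \<one> else z)"
    and "eval_word G f (comm_word (gen x) (inv_word (gen t) @ gen y @ inv_word (gen t))) =
      (if commutes (f x) (f y) then \<one> else z)"
    and "eval_word G f (comm_word (gen x) (inv_word (gen y))) =
      (if commutes (f x) (f y) then \<one> else z)"
proof -
  have c: "f x \<in> carrier G" "f y \<in> carrier G" "f t \<in> carrier G" using f X by auto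
  note [simp] = eval_word_comm_word[OF f] eval_word_append[OF f] eval_word_inv_word[OF f]
    eval_word_gen[OF f]
  show "eval_word G f (comm_word (gen x) (inv_word (gen t) @ gen y @ gen t)) =
      (if commutes (f x) (f y) then \<one> else z)"
    using c X by (simp add: commutator_eq commutes_mult commutes_inv)
  show "eval_word G f (comm_word (gen x) (inv_word (gen t) @ gen y @ inv_word (gen t))) =
      (if commutes (f x) (f y) then \<one> else z)"
    using c X by (simp add: commutator_eq commutes_mult commutes_inv)
  show "eval_word G f (comm_word (gen x) (inv_word (gen y))) =
      (if commutes (f x) (f y) then \<one> else z)"
    using c X commutator_eq[of "f x" "inv (f y)"] by (simp add: commutes_inv)
qed

lemma z_pow: "z [^] (n::nat) = (if even n then \<one> else z)"
  by (induction n) auto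

lemma eval_word_concat_const:
  assumes f: "f \<in> X \<rightarrow> carrier G" and d: "d \<in> carrier G"
    and w: "\<And>i. i \<in> set xs \<Longrightarrow> w i \<in> words X \<and> eval_word G f (w i) = d"
  shows "eval_word G f (concat (map w xs)) = d [^] length xs"
proof -
  have "concat (map w xs) \<in> words X \<and> eval_word G f (concat (map w xs)) = d [^] length xs"
    using w
  proof (induction xs)
    case (Cons x xs)
    then show ?case using d nat_pow_Suc2[OF d, of "length xs"] by (simp add: eval_word_append[OF f])
  qed simp
  then show ?thesis by simp
qed

text \<open>The relators \<open>[a\<^sub>i, s\<^sup>-\<^sup>1 a\<^sub>i s\<^sup>-\<^sup>1]\<close> and \<open>[b\<^sub>i, s\<^sup>-\<^sup>1 b\<^sub>i s\<^sup>-\<^sup>1]\<close> evaluate to \<open>[a\<^sub>i, a\<^sub>i]\<close> and \<open>[b\<^sub>i, b\<^sub>i]\<close>, hence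
  to \<open>1\<close>. Once all \<open>[a\<^sub>i, b\<^sub>i]\<close> equal \<open>s\<^sup>2\<close>, the surface relation is
  \<open>(s\<^sup>2)\<^sup>g = s\<^sup>2\<close>, where \<open>s\<^sup>2\<close> is \<open>1\<close> or \<open>z\<close>.\<close>

lemma respects_braid_rels_iff:
  assumes f: "f \<in> braid_gens g \<rightarrow> carrier G"
  shows "(\<forall>(l, r)\<in>braid_rels g. eval_word G f l = eval_word G f r) \<longleftrightarrow>
    (\<forall>i\<in>{1..g}. \<forall>j\<in>{1..g}. j < i \<longrightarrow>
        commutes (f (A i)) (f (A j)) \<and> commutes (f (A i)) (f (B j)) \<and>
        commutes (f (B i)) (f (A j)) \<and> commutes (f (B i)) (f (B j))) \<and>
    (\<forall>i\<in>{1..g}. commutes (f (A i)) (f (B i)) \<longleftrightarrow> f Sigma \<otimes> f Sigma = \<one>) \<and>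
    (f Sigma \<otimes> f Sigma = \<one> \<or> odd g)"
    (is "?L \<longleftrightarrow> ?R1 \<and> ?R2 \<and> ?R3")
proof -
  let ?e = "eval_word G f" and ?s2 = "f Sigma \<otimes> f Sigma"
  let ?w = "\<lambda>i. comm_word (gen (A i)) (inv_word (gen (B i)))"
  have X: "A i \<in> braid_gens g" "B i \<in> braid_gens g" if "i \<in> {1..g}" for i
    using that by (auto simp: braid_gens_def)
  have S: "Sigma \<in> braid_gens g" by (simp add: braid_gens_def)
  have s: "f Sigma \<in> carrier G" using f S by blast
  have s2: "?s2 = \<one> \<or> ?s2 = z" using square[OF s] .
  note ev = eval_word_comm_word_conj[OF f _ _ S] eval_word_comm_word_conj(3)[OF f]
  have es: "?e (gen Sigma @ gen Sigma) = ?s2"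
    using S by (simp add: eval_word_append[OF f] eval_word_gen[OF f])
  have prod: "?e (concat (map ?w [1..<Suc g])) = ?s2 \<longleftrightarrow> ?R3" if R2: ?R2
  proof -
    have "?w i \<in> words (braid_gens g) \<and> ?e (?w i) = ?s2" if "i \<in> set [1..<Suc g]" for i
    proof -
      have i: "i \<in> {1..g}" using that by auto
      then show ?thesis using X[OF i] ev(4)[of "A i" "B i"] R2 s2 z_neq_one by auto
    qed
    then have "?e (concat (map ?w [1..<Suc g])) = ?s2 [^] length [1..<Suc g]"
      using s by (intro eval_word_concat_const[OF f]) auto
    also have "length [1..<Suc g] = g" by simp
    finally have "?e (concat (map ?w [1..<Suc g])) = ?s2 [^] g" .
    moreover have "?s2 [^] g = ?s2 \<longleftrightarrow> ?R3"
      using s2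
    proof
      assume "?s2 = z"
      then show ?thesis using z_neq_one by (simp add: z_pow)
    qed simp
    ultimately show ?thesis by simp
  qed
  have L: "?L \<longleftrightarrow> ?R1 \<and> ?R2 \<and> ?e (concat (map ?w [1..<Suc g])) = ?s2"
  proof -
    \<comment> \<open>turn quantification over each family of relations into quantification over its indices\<close>
    have ball1: "(\<forall>p\<in>{h i | i. Q i}. P p) \<longleftrightarrow> (\<forall>i. Q i \<longrightarrow> P (h i))"
      for P :: "braid_gen word \<times> braid_gen word \<Rightarrow> bool" and h and Q :: "nat \<Rightarrow> bool" by blast
    have ball2: "(\<forall>p\<in>{h i j | i j. Q i j}. P p) \<longleftrightarrow> (\<forall>i j. Q i j \<longrightarrow> P (h i j))"
      for P :: "braid_gen word \<times> braid_gen word \<Rightarrow> bool" and h and Q :: "nat \<Rightarrow> nat \<Rightarrow> bool" by blast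
    have R2': "((if c then \<one> else z) = ?s2) \<longleftrightarrow> (c \<longleftrightarrow> ?s2 = \<one>)" for c
      using s2 z_neq_one by auto
    have R1': "((if c then \<one> else z) = \<one>) \<longleftrightarrow> c" for c
      using z_neq_one by auto
    show ?thesis
      unfolding braid_rels_def Let_def
      by (simp only: ball_Un ball1 ball2 ball_simps prod.case)
        (simp add: ev es X R1' R2' del: upt_Suc One_nat_def atLeastAtMost_iff cong: imp_cong conj_cong, blast)
  qed
  show ?thesis using L prod by blast
qed

section \<open>Generating vectors and admissible quotients\<close>

text \<open>If \<open>s\<close> does not commute with \<open>t\<close> in \<open>S\<close>, then modulo the centre every \<open>x\<close> in \<open>S\<close> is trivial or
  equal to \<open>t\<close>: one of \<open>x\<close> and \<open>t \<otimes> x\<close> commutes with \<open>s\<close>, hence with all generators. So an element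
  that commutes with both \<open>s\<close> and \<open>t\<close> is central, and such elements make up a quarter of the
  group. If \<open>s\<close> commutes with all of \<open>S\<close>, the group is abelian.\<close>

lemma card_le_8_if_commuting_generators:
  assumes S: "S \<subseteq> carrier G" and s: "s \<in> carrier G"
    and gen: "generate G (insert s S) = carrier G"
    and comm: "\<And>x y. x \<in> S \<Longrightarrow> y \<in> S \<Longrightarrow> commutes x y"
  shows "card (carrier G) \<le> 8"
proof -
  have central: "y \<in> {\<one>, z}"
    if y: "y \<in> carrier G" "commutes y s" "\<And>x. x \<in> S \<Longrightarrow> commutes y x" for y
  proof -
    have "commutes y h" if "h \<in> carrier G" for h
      using commutes_generate[of y "insert s S" h] that y S s gen by auto
    then show ?thesis using y(1) mem_center_iff by blast
  qed
  have central_commutes: "commutes y x" if "x \<in> {\<one>, z}" "y \<in> carrier G" for x y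
    using that by auto
  have card_center: "card {\<one>, z} = 2" using z_neq_one by simp
  show ?thesis
  proof (cases "\<forall>t\<in>S. commutes t s")
    case True
    have "s \<in> {\<one>, z}" using True commutes_sym s by (intro central) auto
    moreover have "x \<in> {\<one>, z}" if "x \<in> S" for x
      using True comm that S by (intro central) auto
    ultimately have "carrier G \<subseteq> {\<one>, z}"
      using central central_commutes by blast
    then have "card (carrier G) \<le> card {\<one>, z}" by (intro card_mono) auto
    then show ?thesis using card_center by linarith
  next
    case False
    then obtain t where t: "t \<in> S" "\<not> commutes t s" by blast
    have tc: "t \<in> carrier G" using t S by blast
    have nst: "\<not> commutes s t" using t commutes_sym by blast
    let ?K = "{h \<in> carrier G. commutes t h \<and> commutes s h}"
    have "?K \<subseteq> {\<one>, z}"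
    proof
      fix y assume "y \<in> ?K"
      then have y: "y \<in> carrier G" "commutes y t" "commutes y s" using commutes_sym by auto
      have "commutes y x" if x: "x \<in> S" for x
      proof (cases "commutes x s")
        case True
        then have "x \<in> {\<one>, z}" using comm x S by (intro central) auto
        then show ?thesis using y central_commutes by blast
      next
        case nxs: False
        have xc: "x \<in> carrier G" using x S by blast
        have "\<not> commutes s x" using nxs commutes_sym by blast
        then have "commutes s (t \<otimes> x)" using nst s tc xc by (simp add: commutes_mult)
        moreover have "commutes u (t \<otimes> x)" if "u \<in> S" for u
          using comm that t x tc xc S by (subst commutes_mult) auto
        ultimately have "t \<otimes> x \<in> {\<one>, z}"
          using tc xc commutes_sym by (intro central) auto
        then have "commutes y (t \<otimes> x)" using y central_commutes by blast
        then show ?thesis using y tc xc by (simp add: commutes_mult)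
      qed
      then show "y \<in> {\<one>, z}" using central y by blast
    qed
    then have "card ?K \<le> card {\<one>, z}" by (intro card_mono) auto
    then show ?thesis
      using card_commutant_pair[OF subgroup_self tc s t(2)] card_center by linarith
  qed
qed

lemma admissible_epi_imp:
  fixes \<phi> :: "braid_gen word set \<Rightarrow> 'a" and g :: nat
  defines "f \<equiv> (\<lambda>x. \<phi> (braid_elt g x))"
  assumes "admissible_epi g G \<phi>"
  shows "f \<in> braid_gens g \<rightarrow> carrier G"
    and "\<forall>(l, r)\<in>braid_rels g. eval_word G f l = eval_word G f r"
    and "generate G (f ` braid_gens g) = carrier G"
proof -
  let ?X = "braid_gens g" and ?R = "braid_rels g"
  have hom: "\<phi> \<in> hom (presented_group ?X ?R) G"
    and onto: "\<phi> ` carrier (presented_group ?X ?R) = carrier G"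
    using assms(2) by (auto simp: admissible_epi_def braid_group_def epi_def)
  have f_eq: "f = (\<lambda>x. \<phi> (word_class ?X ?R (gen x)))" by (simp add: f_def braid_elt_def)
  have carr: "carrier (presented_group ?X ?R) = word_class ?X ?R ` words ?X"
    by (simp add: presented_group_def)
  show f: "f \<in> ?X \<rightarrow> carrier G" using onto unfolding f_eq carr by force
  show "\<forall>(l, r)\<in>?R. eval_word G f l = eval_word G f r"
    using hom_presented_group_respects[OF hom braid_rels_words] unfolding f_eq by blast
  have "\<phi> ` word_class ?X ?R ` words ?X = eval_word G f ` words ?X"
    using hom_presented_group_eq_eval_word[OF hom braid_rels_words]
    unfolding f_eq image_image by (intro image_cong) auto
  then show "generate G (f ` ?X) = carrier G"
    using onto eval_word_image_words[OF f] unfolding carr by simp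
qed

lemma admissible_quotientI:
  assumes f: "f \<in> braid_gens g \<rightarrow> carrier G"
    and rels: "\<forall>(l, r)\<in>braid_rels g. eval_word G f l = eval_word G f r"
    and gen: "generate G (f ` braid_gens g) = carrier G"
    and s: "f Sigma \<noteq> \<one>"
  shows "admissible_quotient g G"
proof -
  let ?X = "braid_gens g" and ?R = "braid_rels g"
  obtain \<phi> where hom: "\<phi> \<in> hom (presented_group ?X ?R) G"
    and ev: "\<And>w. w \<in> words ?X \<Longrightarrow> \<phi> (word_class ?X ?R w) = eval_word G f w"
    using presented_group_universal[OF f braid_rels_words] rels by blast
  have "\<phi> ` carrier (presented_group ?X ?R) = eval_word G f ` words ?X"
    unfolding presented_group_def using ev by (simp add: image_image)
  then have "\<phi> \<in> epi (braid_group g) G"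
    using hom gen eval_word_image_words[OF f] by (simp add: epi_def braid_group_def)
  moreover have Sig: "Sigma \<in> ?X" by (simp add: braid_gens_def)
  then have "\<phi> (braid_elt g Sigma) = f Sigma"
    using ev[of "gen Sigma"] eval_word_gen[OF f] by (simp add: braid_elt_def)
  moreover have "2 \<le> ord (f Sigma)"
  proof -
    have "f Sigma \<in> carrier G" using f Sig by blast
    then have "ord (f Sigma) \<ge> 1" "ord (f Sigma) \<noteq> 1"
      using ord_ge_1[OF finite_carrier] ord_eq_1 s by auto
    then show ?thesis by linarith
  qed
  ultimately have "admissible_epi g G \<phi>"
    using is_group finite_carrier by (simp add: admissible_epi_def)
  then show ?thesis unfolding admissible_quotient_def by blast
qed

text \<open>If \<open>\<sigma>\<close> mapped to an element of square \<open>\<one>\<close>, the relations would make the images of all the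
  remaining generators commute with each other, and the group would be too small.\<close>

lemma admissible_epi_sigma_square:
  assumes "card (carrier G) > 8" and epi: "admissible_epi g G \<phi>"
  shows "\<phi> (braid_elt g Sigma) \<otimes> \<phi> (braid_elt g Sigma) = z" and "odd g"
proof -
  define f where "f = (\<lambda>x. \<phi> (braid_elt g x))"
  note imp = admissible_epi_imp[OF epi, folded f_def]
  note f = imp(1)
  have R1: "\<And>i j. \<lbrakk>i \<in> {1..g}; j \<in> {1..g}; j < i\<rbrakk> \<Longrightarrow>
        commutes (f (A i)) (f (A j)) \<and> commutes (f (A i)) (f (B j)) \<and>
        commutes (f (B i)) (f (A j)) \<and> commutes (f (B i)) (f (B j))"
    and R2: "\<And>i. i \<in> {1..g} \<Longrightarrow> commutes (f (A i)) (f (B i)) \<longleftrightarrow> f Sigma \<otimes> f Sigma = \<one>"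
    and R3: "f Sigma \<otimes> f Sigma = \<one> \<or> odd g"
    using imp(2) unfolding respects_braid_rels_iff[OF f] by blast+
  have s: "f Sigma \<in> carrier G" using f by (auto simp: braid_gens_def)
  have "f Sigma \<otimes> f Sigma \<noteq> \<one>"
  proof
    assume s2: "f Sigma \<otimes> f Sigma = \<one>"
    let ?S = "f ` (A ` {1..g} \<union> B ` {1..g})"
    have "commutes (f (A i)) (f (A j)) \<and> commutes (f (A i)) (f (B j)) \<and>
        commutes (f (B i)) (f (A j)) \<and> commutes (f (B i)) (f (B j))"
      if "i \<in> {1..g}" "j \<in> {1..g}" for i j
      using that R1[of i j] R1[of j i] R2[of i] s2 commutes_sym by (cases i j rule: linorder_cases) auto
    then have "commutes x y" if "x \<in> ?S" "y \<in> ?S" for x y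
      using that by blast
    moreover have "?S \<subseteq> carrier G" using f by (auto simp: braid_gens_def)
    moreover have "generate G (insert (f Sigma) ?S) = carrier G"
      using imp(3) by (simp add: braid_gens_def)
    ultimately have "card (carrier G) \<le> 8" using s by (intro card_le_8_if_commuting_generators) auto
    then show False using assms(1) by simp
  qed
  then show "\<phi> (braid_elt g Sigma) \<otimes> \<phi> (braid_elt g Sigma) = z" "odd g"
    using R3 square[OF s] by (auto simp: f_def)
qed

text \<open>Otherwise every element would be its own inverse, and the group would be abelian.\<close>

lemma exists_square_z:
  assumes "card (carrier G) > 2"
  shows "\<exists>s\<in>carrier G. s \<otimes> s = z"
proof (rule ccontr)
  assume "\<not> ?thesis"
  then have sq: "x \<otimes> x = \<one>" if "x \<in> carrier G" for x
    using square that by blast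
  have inv: "inv x = x" if "x \<in> carrier G" for x
    using that sq by (simp add: inv_equality)
  have "commutes x y" if "x \<in> carrier G" "y \<in> carrier G" for x y
    using inv_mult_group[of x y] inv that by (simp add: commutes_def)
  then have "carrier G \<subseteq> {\<one>, z}" using mem_center_iff by blast
  then have "card (carrier G) \<le> card {\<one>, z}" by (intro card_mono) auto
  then show False using assms z_neq_one by simp
qed

text \<open>Only the classes of the generators modulo the centre are prescribed by the symplectic basis. The
  centre itself is reached because \<open>z\<close> is the square of the generator \<open>s\<close>.\<close>

lemma admissible_quotient_if_odd:
  assumes g: "odd g" and card: "card (carrier G) = 2 ^ (2 * g + 1)"
  shows "admissible_quotient g G"
proof -
  have "(2::nat) ^ 1 < 2 ^ (2 * g + 1)" using g by (intro power_strict_increasing) (auto simp: odd_pos)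
  then have "card (carrier G) > 2" using card by simp
  then obtain s where s: "s \<in> carrier G" "s \<otimes> s = z" using exists_square_z by blast
  have "\<exists>a b. a ` {1..g} \<subseteq> carrier G \<and> b ` {1..g} \<subseteq> carrier G
    \<and> (\<forall>i\<in>{1..g}. \<forall>j\<in>{1..g}. commutes (a i) (a j) \<and> commutes (b i) (b j)
        \<and> (commutes (a i) (b j) \<longleftrightarrow> i \<noteq> j))
    \<and> carrier G \<subseteq> generate G ({z} \<union> a ` {1..g} \<union> b ` {1..g})"
    using mem_center_iff by (intro symplectic_basis subgroup_self card) auto
  then obtain a b where ab: "a ` {1..g} \<subseteq> carrier G" "b ` {1..g} \<subseteq> carrier G"
    and rel: "\<And>i j. \<lbrakk>i \<in> {1..g}; j \<in> {1..g}\<rbrakk> \<Longrightarrow> commutes (a i) (a j) \<and> commutes (b i) (b j)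
        \<and> (commutes (a i) (b j) \<longleftrightarrow> i \<noteq> j)"
    and gen: "carrier G \<subseteq> generate G ({z} \<union> a ` {1..g} \<union> b ` {1..g})"
    by metis
  define f where "f x = (case x of A i \<Rightarrow> a i | B i \<Rightarrow> b i | Sigma \<Rightarrow> s)" for x
  have f: "f \<in> braid_gens g \<rightarrow> carrier G"
    using ab s by (auto simp: braid_gens_def f_def)
  have img: "f ` braid_gens g = insert s (a ` {1..g} \<union> b ` {1..g})"
    by (simp add: braid_gens_def image_Un image_image f_def)
  show ?thesis
  proof (rule admissible_quotientI[OF f])
    show "\<forall>(l, r)\<in>braid_rels g. eval_word G f l = eval_word G f r"
      unfolding respects_braid_rels_iff[OF f]
      using rel s g z_neq_one commutes_sym by (auto simp: f_def)
    show "f Sigma \<noteq> \<one>" using s z_neq_one by (auto simp: f_def)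
    have sub: "subgroup (generate G (f ` braid_gens g)) G"
      using f by (intro generate_is_subgroup) auto
    have "s \<in> generate G (f ` braid_gens g)" unfolding img by (simp add: generate.incl)
    then have "z \<in> generate G (f ` braid_gens g)"
      using subgroup.m_closed[OF sub] s(2) by metis
    moreover have "a ` {1..g} \<union> b ` {1..g} \<subseteq> generate G (f ` braid_gens g)"
      unfolding img by (auto intro: generate.incl)
    ultimately have "generate G ({z} \<union> a ` {1..g} \<union> b ` {1..g}) \<subseteq> generate G (f ` braid_gens g)"
      using generate_subgroup_incl[OF _ sub] by simp
    then show "generate G (f ` braid_gens g) = carrier G"
      using gen subgroup.subset[OF sub] by blast
  qed
qed

end

theorem proposition6p14:
  fixes g :: nat and G :: "('a, 'm) monoid_scheme" and z :: 'a
  assumes "g \<ge> 2"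
    and "extra_special 2 G"
    and "order G = 2 ^ (2 * g + 1)"
    and "z \<in> carrier G" and "center G = generate G {z}"
  shows "(admissible_quotient g G \<longleftrightarrow> odd g) \<and>
    (odd g \<longrightarrow>
      (\<forall>a b s. gv_tuple g a b s \<in> generating_vectors g G \<longrightarrow> s [^]\<^bsub>G\<^esub> (2::nat) = z))"
proof -
  interpret extra_special_2_group G z by (rule extra_special_2_groupI[OF assms(2,4,5)])
  have card: "card (carrier G) = 2 ^ (2 * g + 1)" using assms(3) by (simp add: order_def)
  \<comment> \<open>the place where \<open>g \<ge> 2\<close> matters: for \<open>g = 1\<close> the group has exactly 8 elements\<close>
  have "(2::nat) ^ 3 < 2 ^ (2 * g + 1)" using assms(1) by (intro power_strict_increasing) auto
  then have big: "card (carrier G) > 8" using card by simp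
  have "s [^]\<^bsub>G\<^esub> (2::nat) = z" if gv: "gv_tuple g a b s \<in> generating_vectors g G" for a b s
  proof -
    obtain \<phi> where epi: "admissible_epi g G \<phi>" and "gv_tuple g a b s =
        gv_tuple g (\<lambda>i. \<phi> (braid_elt g (A i))) (\<lambda>i. \<phi> (braid_elt g (B i))) (\<phi> (braid_elt g Sigma))"
      using gv unfolding generating_vectors_def by blast
    then have s: "s = \<phi> (braid_elt g Sigma)" by (simp add: gv_tuple_def)
    have "s \<in> carrier G" using admissible_epi_imp(1)[OF epi] unfolding s by (auto simp: braid_gens_def)
    then show ?thesis using admissible_epi_sigma_square(1)[OF big epi] s by (simp add: numeral_2_eq_2)
  qed
  moreover have "odd g" if "admissible_quotient g G"
    using that admissible_epi_sigma_square(2)[OF big] unfolding admissible_quotient_def by blast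
  ultimately show ?thesis using admissible_quotient_if_odd[OF _ card] by blast
qed

end
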